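(* Let $p,q$ be coprime positive integers, and set $a_m:=S_m(p,q)$ and $G_{p,q}(z)=\sum_{m\ge0}a_mz^m$. For each $\omega\in\mathbb{C}$ with $\omega^{pq}=1$, let $R(\omega):=\operatorname{Res}_{z=\omega}G_{p,q}(z)$. Then the finite Fourier transform $\widehat a(\omega)$ and the residue are related by $$\widehat a(\omega)=-pq\,\omega^{pq-1}R(\omega),$$ and consequently the variance equals the sum of squared moduli of the residues: $$\frac{1}{pq}\sum_{m=0}^{pq-1}|a_m|^2=\sum_{\omega^{pq}=1}|R(\omega)|^2.$$
   Context: For coprime positive integers $p,q$ and an integer $m$, $S_m(p,q)=\sum_{\zeta\in\mathcal{Z}_{p,q}}\zeta^m$, where $\mathcal{Z}_{p,q}=\{\zeta\in\mathbb{C}:\zeta^{pq}=1,\ \zeta^p\ne1,\ \zeta^q\ne1\}$ is the set of zeros of the Alexander polynomial of the torus knot $T_{p,q}$; the sequence is $pq$-periodic in $m$. $G_{p,q}(z)$ is defined by its power series for $|z|<1$ and extended meromorphically to $\mathbb{C}$. For an $N$-periodic complex sequence $(a_m)$ and an $N$-th root of unity $\omega$, $\widehat a(\omega):=\sum_{m=0}^{N-1}a_m\omega^m$ (here $N=pq$). *)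

theory Defs
  imports "HOL-Complex_Analysis.Complex_Analysis"
begin

definition torus_zeros :: "nat \<Rightarrow> nat \<Rightarrow> complex set" where
  "torus_zeros p q = {\<zeta>. \<zeta> ^ (p * q) = 1 \<and> \<zeta> ^ p \<noteq> 1 \<and> \<zeta> ^ q \<noteq> 1}"

definition torus_S :: "int \<Rightarrow> nat \<Rightarrow> nat \<Rightarrow> complex" where
  "torus_S m p q = (\<Sum>\<zeta>\<in>torus_zeros p q. \<zeta> powi m)"

(* G is the meromorphic extension to the whole plane of the power series with coefficients a,
   which is required to converge on the open unit disc.  With nicely_meromorphic_on, G has the
   value 0 at its poles and no removable singularities, so it is unique as a function. *)
definition is_meromorphic_gf :: "(nat \<Rightarrow> complex) \<Rightarrow> (complex \<Rightarrow> complex) \<Rightarrow> bool" where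
  "is_meromorphic_gf a G \<longleftrightarrow> G nicely_meromorphic_on UNIV \<and>
     (\<forall>z. norm z < 1 \<longrightarrow> (\<lambda>m. a m * z ^ m) sums G z)"

definition torus_G :: "nat \<Rightarrow> nat \<Rightarrow> complex \<Rightarrow> complex" where
  "torus_G p q = (THE G. is_meromorphic_gf (\<lambda>m. torus_S (int m) p q) G)"

definition finite_fourier :: "nat \<Rightarrow> (nat \<Rightarrow> complex) \<Rightarrow> complex \<Rightarrow> complex" where
  "finite_fourier N a \<omega> = (\<Sum>m<N. a m * \<omega> ^ m)"

lemma is_meromorphic_gf_unique:
  assumes f: "is_meromorphic_gf a f" and g: "is_meromorphic_gf a g"
  shows "f = g"
proof
  fix w :: complex
  define h where "h = remove_sings (\<lambda>z. f z - g z)"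
  have nf: "f nicely_meromorphic_on UNIV" and ng: "g nicely_meromorphic_on UNIV"
    using f g by (auto simp: is_meromorphic_gf_def)
  then have mf: "f meromorphic_on UNIV" and mg: "g meromorphic_on UNIV"
    by (auto simp: nicely_meromorphic_on_def)
  have md: "(\<lambda>z. f z - g z) meromorphic_on UNIV"
    using mf mg by (intro meromorphic_intros)
  have nh: "h nicely_meromorphic_on UNIV"
    unfolding h_def by (rule remove_sings_nicely_meromorphic[OF md])
  have eq: "f z = g z" if "norm z < 1" for z
    using that f g by (auto simp: is_meromorphic_gf_def intro: sums_unique2)
  have evd: "eventually (\<lambda>z. h z = f z - g z) (at v)" for v
    unfolding h_def
    by (rule eventually_remove_sings_eq_at)
       (rule meromorphic_on_isolated_singularity[OF meromorphic_on_subset[OF md subset_UNIV]])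
  have "eventually (\<lambda>z. z \<in> ball 0 1) (at (0::complex))"
    by (rule eventually_at_in_open') auto
  with evd[of 0] have "eventually (\<lambda>z. h z = 0) (at 0)"
    by eventually_elim (simp add: eq)
  then have "frequently (\<lambda>z. h z = 0) (at 0)"
    by (simp add: eventually_frequently)
  then have h0: "h z = 0" for z
    by (rule frequently_eq_meromorphic_imp_constant[OF _ nh]) auto
  have ev: "eventually (\<lambda>z. f z = g z) (at w)"
    using evd[of w] by eventually_elim (simp add: h0)
  have pole: "is_pole f w \<longleftrightarrow> is_pole g w"
    by (rule is_pole_cong[OF ev refl])
  show "f w = g w"
  proof (cases "is_pole f w")
    case True
    then have "\<not> f \<midarrow>w\<rightarrow> f w" "\<not> g \<midarrow>w\<rightarrow> g w"
      using pole not_tendsto_and_filterlim_at_infinity[of "at w"]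
      by (auto simp: is_pole_def)
    then have "f w = 0" "g w = 0"
      using nf ng unfolding nicely_meromorphic_on_def by blast+
    then show ?thesis by simp
  next
    case False
    then have "f \<midarrow>w\<rightarrow> f w" "g \<midarrow>w\<rightarrow> g w"
      using nf ng pole by (auto simp: nicely_meromorphic_on_def)
    then show ?thesis
      using tendsto_cong[OF ev] tendsto_unique[of "at w"] by auto
  qed
qed

lemma finite_torus_zeros: "finite (torus_zeros p q)"
proof (cases "p * q = 0")
  case True
  then show ?thesis by (auto simp: torus_zeros_def)
next
  case False
  then have "finite {\<zeta>::complex. \<zeta> ^ (p * q) = 1}"
    by (intro finite_roots_unity) linarith
  then show ?thesis
    by (rule finite_subset[rotated]) (auto simp: torus_zeros_def)
qed

lemma norm_torus_zeros:
  assumes "\<zeta> \<in> torus_zeros p q"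
  shows "norm \<zeta> = 1"
proof -
  have "p * q > 0" using assms by (auto simp: torus_zeros_def intro!: Nat.gr0I)
  with assms show ?thesis
    using power_eq_1_iff[of \<zeta> "p * q"] by (simp add: torus_zeros_def)
qed

lemma is_meromorphic_gf_torus_G: "is_meromorphic_gf (\<lambda>m. torus_S (int m) p q) (torus_G p q)"
proof -
  define F where "F = (\<lambda>z. \<Sum>\<zeta>\<in>torus_zeros p q. 1 / (1 - \<zeta> * z))"
  have "F meromorphic_on UNIV"
    unfolding F_def by (intro meromorphic_intros)
  then have nF: "remove_sings F nicely_meromorphic_on UNIV"
    by (rule remove_sings_nicely_meromorphic)
  have "(\<lambda>m. torus_S (int m) p q * z ^ m) sums remove_sings F z" if z: "norm z < 1" for z
  proof -
    have nz: "1 - \<zeta> * z \<noteq> 0" if "\<zeta> \<in> torus_zeros p q" for \<zeta>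
    proof
      assume "1 - \<zeta> * z = 0"
      then have "norm (\<zeta> * z) = 1" by simp
      with norm_torus_zeros[OF that] z show False by (simp add: norm_mult)
    qed
    have "F analytic_on {z}"
      unfolding F_def using nz by (intro analytic_intros) auto
    then have "remove_sings F z = F z" by simp
    moreover have "(\<lambda>m. \<Sum>\<zeta>\<in>torus_zeros p q. (\<zeta> * z) ^ m) sums F z"
      unfolding F_def
      by (intro sums_sum geometric_sums) (simp add: norm_mult norm_torus_zeros z)
    ultimately show ?thesis
      by (simp add: torus_S_def sum_distrib_right power_mult_distrib)
  qed
  with nF have "is_meromorphic_gf (\<lambda>m. torus_S (int m) p q) (remove_sings F)"
    by (simp add: is_meromorphic_gf_def)
  then show ?thesis
    unfolding torus_G_def by (metis theI is_meromorphic_gf_unique)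
qed

end

theory Submission
  imports Defs
begin

text \<open>Summing geometric series over the zeros gives \<open>G z = (\<Sum>\<zeta>. 1 / (1 - \<zeta> z))\<close> off the poles,
  so \<open>R \<omega> = - \<omega>\<close> if \<open>1 / \<omega>\<close> is one of the zeros and \<open>R \<omega> = 0\<close> otherwise.
  Orthogonality of the characters of the cyclic group evaluates the Fourier transform and
  shows that both sides of the variance identity equal the number of zeros.\<close>

lemma sum_powers_root_of_unity:
  fixes w :: "'a::field"
  assumes "w ^ N = 1"
  shows "(\<Sum>m<N. w ^ m) = (if w = 1 then of_nat N else 0)"
  using assms by (auto simp: geometric_sum)

text \<open>The right-hand side is nicely meromorphic and agrees with the power series on the unit
  disc, so uniqueness of the extension applies. \<open>remove_sings\<close> normalizes the values at
  the poles: since \<open>1 / 0 = 0\<close>, the bare sum takes there the value of its other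
  summands, not 0.\<close>

lemma torus_G_eq:
  "torus_G p q = remove_sings (\<lambda>z. \<Sum>\<zeta>\<in>torus_zeros p q. 1 / (1 - \<zeta> * z))"
proof (rule is_meromorphic_gf_unique[OF is_meromorphic_gf_torus_G])
  let ?F = "\<lambda>z. \<Sum>\<zeta>\<in>torus_zeros p q. 1 / (1 - \<zeta> * z)"
  have "?F meromorphic_on UNIV"
    by (intro meromorphic_intros)
  moreover have "(\<lambda>m. torus_S (int m) p q * z ^ m) sums remove_sings ?F z" if z: "norm z < 1" for z
  proof -
    have norm_lt: "norm (\<zeta> * z) < 1" if "\<zeta> \<in> torus_zeros p q" for \<zeta>
      using norm_torus_zeros[OF that] z by (simp add: norm_mult)
    then have nz: "1 - \<zeta> * z \<noteq> 0" if "\<zeta> \<in> torus_zeros p q" for \<zeta>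
      using that by fastforce
    have "?F analytic_on {z}"
      using nz by (intro analytic_intros) auto
    moreover have "(\<lambda>m. \<Sum>\<zeta>\<in>torus_zeros p q. (\<zeta> * z) ^ m) sums ?F z"
      by (intro sums_sum geometric_sums norm_lt)
    ultimately show ?thesis
      by (simp add: torus_S_def sum_distrib_right power_mult_distrib)
  qed
  ultimately show "is_meromorphic_gf (\<lambda>m. torus_S (int m) p q) (remove_sings ?F)"
    by (simp add: is_meromorphic_gf_def remove_sings_nicely_meromorphic)
qed

lemma residue_sum:
  assumes "open S" "z \<in> S" "\<And>i. i \<in> I \<Longrightarrow> f i holomorphic_on S - {z}"
  shows "residue (\<lambda>w. \<Sum>i\<in>I. f i w) z = (\<Sum>i\<in>I. residue (f i) z)"
  using assms(3)
proof (induction I rule: infinite_finite_induct)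
  case (insert i I)
  then show ?case
    using assms(1,2) by (simp add: residue_add[of S] holomorphic_on_sum)
qed (simp_all add: residue_const)

lemma residue_geometric:
  fixes \<zeta> \<omega> :: complex
  assumes "\<zeta> \<noteq> 0"
  shows "residue (\<lambda>z. 1 / (1 - \<zeta> * z)) \<omega> = (if \<zeta> * \<omega> = 1 then - \<omega> else 0)"
proof (cases "\<zeta> * \<omega> = 1")
  case True
  \<comment> \<open>Here \<open>1 - \<zeta> * z = - (z - \<omega>) / \<omega>\<close>. Both
    functions are 0 at \<open>\<omega>\<close> by division by zero, so they are equal
    everywhere.\<close>
  then have "(\<lambda>z. 1 / (1 - \<zeta> * z)) = (\<lambda>z. - \<omega> / (z - \<omega>))"
    using assms by (intro ext) (auto simp: divide_simps, algebra+)
  then show ?thesis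
    using residue_simple[of UNIV \<omega> "\<lambda>_. - \<omega>"] by (simp add: True)
next
  case False
  then have "(\<lambda>z. 1 / (1 - \<zeta> * z)) analytic_on {\<omega>}"
    by (intro analytic_intros) auto
  then show ?thesis
    using False by (auto simp: analytic_at intro: residue_holo)
qed

text \<open>At most one summand is nonzero. The sum is kept so that it can be compared term by term
  with the one for the Fourier transform.\<close>

lemma residue_torus_G:
  "residue (torus_G p q) \<omega> = (\<Sum>\<zeta>\<in>torus_zeros p q. if \<zeta> * \<omega> = 1 then - \<omega> else 0)"
proof -
  have "residue (torus_G p q) \<omega> = residue (\<lambda>z. \<Sum>\<zeta>\<in>torus_zeros p q. 1 / (1 - \<zeta> * z)) \<omega>"
    unfolding torus_G_eq
    by (intro residue_cong eventually_remove_sings_eq_at meromorphic_on_isolated_singularity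
          meromorphic_intros refl)
  also have "\<dots> = (\<Sum>\<zeta>\<in>torus_zeros p q. residue (\<lambda>z. 1 / (1 - \<zeta> * z)) \<omega>)"
  proof (rule residue_sum)
    \<comment> \<open>All poles other than \<open>\<omega>\<close> are removed, so every summand is
      holomorphic on \<open>?S - {\<omega>}\<close>, whether or not \<open>\<omega>\<close> is
      itself a pole.\<close>
    let ?S = "- (inverse ` torus_zeros p q - {\<omega>})"
    show "open ?S"
      by (intro open_Compl finite_imp_closed finite_Diff finite_imageI finite_torus_zeros)
    show "(\<lambda>z. 1 / (1 - \<zeta> * z)) holomorphic_on ?S - {\<omega>}" if "\<zeta> \<in> torus_zeros p q" for \<zeta>
      using that by (intro holomorphic_intros) (auto dest: inverse_unique)
  qed simp
  also have "\<dots> = (\<Sum>\<zeta>\<in>torus_zeros p q. if \<zeta> * \<omega> = 1 then - \<omega> else 0)"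
    using norm_torus_zeros by (intro sum.cong refl residue_geometric) fastforce
  finally show ?thesis .
qed

text \<open>After the two sums are exchanged, each inner sum runs over the powers of the root of
  unity \<open>\<zeta> * \<omega>\<close>.\<close>

lemma finite_fourier_torus_S:
  assumes "\<omega> ^ (p * q) = 1"
  shows "finite_fourier (p * q) (\<lambda>m. torus_S (int m) p q) \<omega> =
    (\<Sum>\<zeta>\<in>torus_zeros p q. if \<zeta> * \<omega> = 1 then of_nat (p * q) else 0)"
proof -
  have "finite_fourier (p * q) (\<lambda>m. torus_S (int m) p q) \<omega> =
      (\<Sum>\<zeta>\<in>torus_zeros p q. \<Sum>m<p * q. (\<zeta> * \<omega>) ^ m)"
    unfolding finite_fourier_def torus_S_def
    by (subst sum.swap) (simp add: sum_distrib_right power_mult_distrib)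
  also have "\<dots> = (\<Sum>\<zeta>\<in>torus_zeros p q. if \<zeta> * \<omega> = 1 then of_nat (p * q) else 0)"
    using assms
    by (intro sum.cong refl sum_powers_root_of_unity)
       (simp add: torus_zeros_def power_mult_distrib)
  finally show ?thesis .
qed

text \<open>Expanding each squared modulus gives a double sum over pairs of zeros. Orthogonality
  kills the off-diagonal pairs, and each diagonal pair contributes \<open>p * q\<close>.\<close>

lemma sum_norm_torus_S:
  "(\<Sum>m<p * q. (cmod (torus_S (int m) p q))\<^sup>2) = real (p * q) * real (card (torus_zeros p q))"
proof -
  let ?Z = "torus_zeros p q"
  \<comment> \<open>On the unit circle conjugation is inversion.\<close>
  have cnj_eq: "\<zeta> * cnj \<eta> = 1 \<longleftrightarrow> \<zeta> = \<eta>" if "\<zeta> \<in> ?Z" "\<eta> \<in> ?Z" for \<zeta> \<eta>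
  proof -
    have "\<eta> * cnj \<eta> = 1" "\<eta> \<noteq> 0"
      using norm_torus_zeros[OF that(2)] by (auto simp: complex_norm_square[symmetric])
    then show ?thesis by (metis mult_cancel_right mult_zero_right zero_neq_one)
  qed
  have "complex_of_real (\<Sum>m<p * q. (cmod (torus_S (int m) p q))\<^sup>2) =
      (\<Sum>m<p * q. \<Sum>\<zeta>\<in>?Z. \<Sum>\<eta>\<in>?Z. (\<zeta> * cnj \<eta>) ^ m)"
    unfolding of_real_sum complex_norm_square torus_S_def
    by (simp add: sum_product power_mult_distrib)
  also have "\<dots> = (\<Sum>\<zeta>\<in>?Z. \<Sum>\<eta>\<in>?Z. \<Sum>m<p * q. (\<zeta> * cnj \<eta>) ^ m)"
    by (subst sum.swap, intro sum.cong refl, rule sum.swap)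
  also have "\<dots> = (\<Sum>\<zeta>\<in>?Z. \<Sum>\<eta>\<in>?Z. if \<zeta> = \<eta> then of_nat (p * q) else 0)"
  proof (intro sum.cong refl)
    fix \<zeta> \<eta> assume Z: "\<zeta> \<in> ?Z" "\<eta> \<in> ?Z"
    then have "(\<zeta> * cnj \<eta>) ^ (p * q) = 1"
      by (simp add: torus_zeros_def power_mult_distrib flip: complex_cnj_power)
    then show "(\<Sum>m<p * q. (\<zeta> * cnj \<eta>) ^ m) = (if \<zeta> = \<eta> then of_nat (p * q) else 0)"
      by (simp add: sum_powers_root_of_unity cnj_eq[OF Z])
  qed
  also have "\<dots> = of_real (real (p * q) * real (card ?Z))"
    by (simp add: finite_torus_zeros)
  finally show ?thesis
    by (simp only: of_real_eq_iff)
qed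

text \<open>The zeros are closed under inversion, so among the roots of unity the residue is nonzero
  exactly at the zeros, where it has modulus 1.\<close>

lemma sum_norm_residue_torus_G:
  assumes "p * q > 0"
  shows "(\<Sum>\<omega> | \<omega> ^ (p * q) = 1. (cmod (residue (torus_G p q) \<omega>))\<^sup>2) = real (card (torus_zeros p q))"
proof -
  let ?Z = "torus_zeros p q"
  have inverse_in: "inverse \<omega> \<in> ?Z \<longleftrightarrow> \<omega> \<in> ?Z" for \<omega>
    by (simp add: torus_zeros_def power_inverse)
  have "(cmod (residue (torus_G p q) \<omega>))\<^sup>2 = of_bool (\<omega> \<in> ?Z)" if "\<omega> ^ (p * q) = 1" for \<omega>
  proof -
    have "\<omega> \<noteq> 0" using that assms by (auto simp: power_0_left)
    then have "\<zeta> * \<omega> = 1 \<longleftrightarrow> \<zeta> = inverse \<omega>" for \<zeta>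
      by (auto simp: field_simps)
    then have "residue (torus_G p q) \<omega> = (if \<omega> \<in> ?Z then - \<omega> else 0)"
      by (simp add: residue_torus_G finite_torus_zeros inverse_in)
    then show ?thesis
      by (simp add: norm_torus_zeros)
  qed
  then have "(\<Sum>\<omega> | \<omega> ^ (p * q) = 1. (cmod (residue (torus_G p q) \<omega>))\<^sup>2) =
      (\<Sum>\<omega> | \<omega> ^ (p * q) = 1. of_bool (\<omega> \<in> ?Z))"
    by (intro sum.cong) auto
  also have "\<dots> = real (card ({\<omega>. \<omega> ^ (p * q) = 1} \<inter> ?Z))"
    using assms by (simp add: finite_roots_unity Int_def)
  also have "{\<omega>. \<omega> ^ (p * q) = 1} \<inter> ?Z = ?Z"
    by (auto simp: torus_zeros_def)
  finally show ?thesis .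
qed

theorem corollary3p12:
  fixes p q :: nat and a :: "nat \<Rightarrow> complex" and G R :: "complex \<Rightarrow> complex"
  assumes "p > 0" and "q > 0" and "coprime p q"
    and "a = (\<lambda>m. torus_S (int m) p q)"
    and "G = torus_G p q"
    and "R = (\<lambda>\<omega>. residue G \<omega>)"
  shows "(\<forall>\<omega>. \<omega> ^ (p * q) = 1 \<longrightarrow>
            finite_fourier (p * q) a \<omega> = - of_nat (p * q) * \<omega> ^ (p * q - 1) * R \<omega>) \<and>
         (1 / real (p * q)) * (\<Sum>m<p * q. (cmod (a m))\<^sup>2)
           = (\<Sum>\<omega> | \<omega> ^ (p * q) = 1. (cmod (R \<omega>))\<^sup>2)"
proof (intro conjI allI impI)
  have pq: "p * q > 0" using assms(1,2) by simp
  fix \<omega> :: complex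
  assume \<omega>: "\<omega> ^ (p * q) = 1"
  then have "\<omega> ^ (p * q - 1) * \<omega> = 1"
    using power_minus_mult[OF pq] by metis
  \<comment> \<open>As \<open>\<omega> ^ (p * q - 1)\<close> is the inverse of
    \<open>\<omega>\<close>, the prefactor turns a residue \<open>- \<omega>\<close> into
    \<open>p * q\<close>, and the two sums over the zeros agree termwise.\<close>
  then have "- of_nat (p * q) * \<omega> ^ (p * q - 1) * - \<omega> = of_nat (p * q)"
    by simp
  then show "finite_fourier (p * q) a \<omega> = - of_nat (p * q) * \<omega> ^ (p * q - 1) * R \<omega>"
    unfolding assms(4-6) finite_fourier_torus_S[OF \<omega>] residue_torus_G sum_distrib_left
    by (intro sum.cong) auto
next
  have "p * q > 0" using assms(1,2) by simp
  then show "(1 / real (p * q)) * (\<Sum>m<p * q. (cmod (a m))\<^sup>2)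
      = (\<Sum>\<omega> | \<omega> ^ (p * q) = 1. (cmod (R \<omega>))\<^sup>2)"
    unfolding assms(4-6) sum_norm_torus_S
    using assms(1,2) by (simp add: sum_norm_residue_torus_G)
qed

end
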